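(* Let $q$ be a prime power, let $n,t$ be positive integers, let $s$ be a positive integer with $\gcd(s,n)=1$, and let $\sigma\colon x\mapsto x^{q^s}$, an automorphism of $\mathbb{F}_{q^{nt}}$ (so that $\sigma|_{\mathbb{F}_{q^n}}$ has order $n$). Let $b_0,\dots,b_{t-1}\in\mathbb{F}_{q^{nt}}$ and let \[ f(x)=-x+b_0x^{\sigma}+b_1x^{\sigma q^n}+b_2x^{\sigma q^{2n}}+\cdots+b_{t-1}x^{\sigma q^{n(t-1)}}. \] Let $G(x)=\sum_{i=0}^{t-1}b_ix^{q^{ni}}$, so that $f(x)=(G\circ\sigma)(x)-x$. Then: 1. $\dim_{\mathbb{F}_q}\ker f\le t$; 2. $\ker f=\{0\}$ if and only if $\ker((G\circ\sigma)^n-\mathrm{id})=\{0\}$; 3. more generally, $\dim_{\mathbb{F}_q}\ker f=\dim_{\mathbb{F}_{q^n}}\ker((G\circ\sigma)^n-\mathrm{id})$. In particular, $\dim_{\mathbb{F}_q}\ker f=t$ if and only if $(G\circ\sigma)^n=\mathrm{id}$.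
   Context: Notation: $x^{\sigma q^{ni}}:=x^{q^{s+ni}}$. All polynomials are identified with the maps $\mathbb{F}_{q^{nt}}\to\mathbb{F}_{q^{nt}}$ they induce; $\ker f$ is the set of roots of $f$ in $\mathbb{F}_{q^{nt}}$, an $\mathbb{F}_q$-subspace. $H^n$ denotes the $n$-fold composition $H\circ\cdots\circ H$, and $\mathrm{id}$ is the identity map of $\mathbb{F}_{q^{nt}}$. The map $(G\circ\sigma)^n$ is $\mathbb{F}_{q^n}$-linear on $\mathbb{F}_{q^{nt}}$, so the kernel in item 3 is an $\mathbb{F}_{q^n}$-subspace. *)

theory Defs
  imports "HOL-Algebra.Embedded_Algebras" "HOL-Number_Theory.Prime_Powers"
begin

text \<open>
  Polynomials over the field \<open>F\<close> with \<open>q^(n*t)\<close> elements are identified with the maps they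
  induce on \<open>carrier F\<close>.
\<close>

definition frob :: "('a, 'm) ring_scheme \<Rightarrow> nat \<Rightarrow> nat \<Rightarrow> 'a \<Rightarrow> 'a" where
  "frob F q s x = x [^]\<^bsub>F\<^esub> (q ^ s)"

definition G_map ::
    "('a, 'm) ring_scheme \<Rightarrow> nat \<Rightarrow> nat \<Rightarrow> nat \<Rightarrow> (nat \<Rightarrow> 'a) \<Rightarrow> 'a \<Rightarrow> 'a" where
  "G_map F q n t b x = (\<Oplus>\<^bsub>F\<^esub>i\<in>{..<t}. b i \<otimes>\<^bsub>F\<^esub> x [^]\<^bsub>F\<^esub> (q ^ (n * i)))"

text \<open>The exponent \<open>q^(s + n*i)\<close> is that of \<open>\<sigma>\<close> followed by the power map \<open>q^(n*i)\<close>.\<close>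

definition f_map ::
    "('a, 'm) ring_scheme \<Rightarrow> nat \<Rightarrow> nat \<Rightarrow> nat \<Rightarrow> nat \<Rightarrow> (nat \<Rightarrow> 'a) \<Rightarrow> 'a \<Rightarrow> 'a" where
  "f_map F q n t s b x =
     (\<ominus>\<^bsub>F\<^esub> x) \<oplus>\<^bsub>F\<^esub> (\<Oplus>\<^bsub>F\<^esub>i\<in>{..<t}. b i \<otimes>\<^bsub>F\<^esub> x [^]\<^bsub>F\<^esub> (q ^ (s + n * i)))"

lemma f_map_eq_G_map_frob:
  assumes "field F" and b: "b \<in> {..<t} \<rightarrow> carrier F" and x: "x \<in> carrier F"
  shows "f_map F q n t s b x = (G_map F q n t b \<circ> frob F q s) x \<ominus>\<^bsub>F\<^esub> x"
proof -
  interpret field F by fact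
  have "(\<Oplus>\<^bsub>F\<^esub>i\<in>{..<t}. b i \<otimes>\<^bsub>F\<^esub> x [^]\<^bsub>F\<^esub> (q ^ (s + n * i))) = G_map F q n t b (frob F q s x)"
    using x by (simp add: G_map_def frob_def nat_pow_pow power_add)
  moreover have "G_map F q n t b (frob F q s x) \<in> carrier F"
    unfolding G_map_def frob_def using b x by (intro finsum_closed) auto
  ultimately show ?thesis
    using x by (simp add: f_map_def minus_eq a_comm)
qed

end

theory Submission
  imports Defs "HOL-Algebra.Multiplicative_Group"
begin

text \<open>
  The map \<open>H = G \<circ> \<sigma>\<close> is additive and \<open>\<sigma>\<close>-semilinear over the field \<open>L\<close> with \<open>q^n\<close> elements, and
  \<open>ker f\<close> is the set of fixed points of \<open>H\<close>, contained in \<open>W = ker (H^n - id)\<close>. Vectors fixed by \<open>H\<close>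
  that are independent over \<open>K\<close> stay independent over \<open>L\<close>: apply \<open>H\<close> to an \<open>L\<close>-linear relation and
  compare coefficients. They also span \<open>W\<close> over \<open>L\<close>: for \<open>x \<in> W\<close> and all \<open>l \<in> L\<close> the trace
  \<open>\<Sum>i<n. H^i (l x) = \<Sum>i<n. \<sigma>^i(l) H^i(x)\<close> is fixed by \<open>H\<close>, and since the \<open>\<sigma>^i\<close> are distinct on
  \<open>L\<close>, Dedekind's argument puts \<open>x\<close> itself into the span. Hence the two dimensions agree, and counting
  the elements of \<open>W\<close> inside the whole field gives the comparison with \<open>t\<close>.
\<close>

section \<open>Additivity of p-power maps in characteristic p\<close>

lemma (in cring) binomial_theorem:
  assumes x: "x \<in> carrier R" and y: "y \<in> carrier R"
  shows "(x \<oplus> y) [^] (n::nat) = (\<Oplus>k\<in>{..n}. [(n choose k)] \<cdot> (x [^] k \<otimes> y [^] (n - k)))"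
proof (induction n)
  case 0
  show ?case by simp
next
  case (Suc n)
  define T where "T m k = [(m choose k)] \<cdot> (x [^] k \<otimes> y [^] (m - k))" for m k :: nat
  \<comment> \<open>\<open>A\<close> and \<open>B\<close> are the terms of the expansion for
    \<open>n\<close> multiplied by \<open>x\<close> and by \<open>y\<close>. After a shift of index
    in \<open>B\<close>, Pascal's rule combines them into the terms for
    \<open>Suc n\<close>.\<close>
  define A where "A k = [(n choose k)] \<cdot> (x [^] Suc k \<otimes> y [^] (n - k))" for k
  define B where "B k = [(n choose k)] \<cdot> (x [^] k \<otimes> y [^] (Suc n - k))" for k
  have cl: "T m k \<in> carrier R" "A k \<in> carrier R" "B k \<in> carrier R" for m k
    using x y by (auto simp: T_def A_def B_def)
  have "T n k \<otimes> x = A k" "k \<le> n \<Longrightarrow> T n k \<otimes> y = B k" for k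
    using x y by (simp_all add: T_def A_def B_def add_pow_ldistr add_pow_rdistr m_ac Suc_diff_le)
  then have "finsum R (T n) {..n} \<otimes> x = finsum R A {..n}" "finsum R (T n) {..n} \<otimes> y = finsum R B {..n}"
    using x y cl by (auto simp: finsum_ldistr intro!: finsum_cong')
  \<comment> \<open>The added term has the coefficient \<open>n choose Suc n\<close>, which is 0.
    The longer range allows index 0 to be split off, so that the rest is indexed like
    \<open>A\<close>.\<close>
  moreover have "finsum R B {..n} = finsum R B {..Suc n}"
    using cl x y finsum_Suc[of B n] B_def[of "Suc n"] by (simp add: binomial_eq_0)
  moreover have "finsum R B {..Suc n} = finsum R (\<lambda>k. B (Suc k)) {..n} \<oplus> B 0"
    using cl by (intro finsum_Suc2) auto
  moreover have "finsum R (T (Suc n)) {..Suc n} = finsum R (\<lambda>k. T (Suc n) (Suc k)) {..n} \<oplus> T (Suc n) 0"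
    using cl by (intro finsum_Suc2) auto
  moreover have "finsum R (\<lambda>k. T (Suc n) (Suc k)) {..n} = finsum R (\<lambda>k. A k \<oplus> B (Suc k)) {..n}"
    using x y cl by (intro finsum_cong') (auto simp: T_def A_def B_def add.nat_pow_mult[symmetric])
  moreover have "\<dots> = finsum R A {..n} \<oplus> finsum R (\<lambda>k. B (Suc k)) {..n}"
    using cl by (intro finsum_addf) auto
  moreover have "T (Suc n) 0 = B 0"
    by (simp add: T_def B_def)
  moreover have "(x \<oplus> y) [^] n = finsum R (T n) {..n}"
    using Suc by (simp add: T_def[abs_def])
  then have "(x \<oplus> y) [^] Suc n = finsum R (T n) {..n} \<otimes> x \<oplus> finsum R (T n) {..n} \<otimes> y"
    using x y cl by (simp add: r_distr)
  ultimately have "(x \<oplus> y) [^] Suc n = finsum R (T (Suc n)) {..Suc n}"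
    using cl by (simp add: a_assoc)
  then show ?case
    by (simp add: T_def[abs_def])
qed

text \<open>All binomial coefficients strictly between the two ends are divisible by
  \<open>p\<close> and hence vanish in the ring.\<close>

lemma (in cring) pow_prime_add:
  assumes x: "x \<in> carrier R" and y: "y \<in> carrier R"
    and p: "prime (p::nat)" and char: "[p] \<cdot> \<one> = \<zero>"
  shows "(x \<oplus> y) [^] p = x [^] p \<oplus> y [^] p"
proof -
  define T where "T k = [(p choose k)] \<cdot> (x [^] k \<otimes> y [^] (p - k))" for k :: nat
  have cl: "T k \<in> carrier R" for k
    using x y by (auto simp: T_def)
  \<comment> \<open>With \<open>p\<close> in this form the inner indices are exactly
    \<open>Suc k\<close> for k \<le> m.\<close>
  obtain m where m: "p = Suc (Suc m)"
    using prime_ge_2_nat[OF p] by (metis Suc_le_D numeral_2_eq_2 Suc_le_mono)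
  have T0: "T (Suc k) = \<zero>" if "k \<le> m" for k
  proof -
    have "p dvd (p choose Suc k)"
      using p that by (intro dvd_choose_prime) (auto simp: m)
    then obtain c where c: "(p choose Suc k) = p * c"
      by (rule dvdE)
    have "[p] \<cdot> z = \<zero>" if "z \<in> carrier R" for z
      using add_pow_ldistr[of \<one> z p] that char by simp
    then show ?thesis
      unfolding T_def c using x y by (simp add: add.nat_pow_pow[symmetric] mult.commute)
  qed
  have "(x \<oplus> y) [^] p = finsum R T {..Suc (Suc m)}"
    using binomial_theorem[OF x y, of p] by (simp add: T_def[abs_def] m)
  also have "\<dots> = T (Suc (Suc m)) \<oplus> (finsum R (\<lambda>k. T (Suc k)) {..m} \<oplus> T 0)"
    using cl finsum_Suc[of T "Suc m"] finsum_Suc2[of T m] by (simp add: Pi_def m)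
  also have "finsum R (\<lambda>k. T (Suc k)) {..m} = \<zero>"
    using T0 by (intro add.finprod_one_eqI) auto
  finally show ?thesis
    using x y by (simp add: T_def m[symmetric])
qed

lemma (in cring) pow_prime_power_add:
  assumes "x \<in> carrier R" and "y \<in> carrier R"
    and p: "prime (p::nat)" and char: "[p] \<cdot> \<one> = \<zero>"
  shows "(x \<oplus> y) [^] (p ^ k) = x [^] (p ^ k) \<oplus> y [^] (p ^ k)"
proof (induction k)
  case (Suc k)
  then show ?case
    using assms pow_prime_add[OF _ _ p char, of "x [^] (p ^ k)" "y [^] (p ^ k)"]
    by (simp add: nat_pow_pow[symmetric] mult.commute[of p])
qed (use assms in auto)

section \<open>Subfields of a finite field as fixed points of power maps\<close>

lemma (in field) pow_order_eq_self:
  assumes fin: "finite (carrier R)" and x: "x \<in> carrier R"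
  shows "x [^] order R = x"
proof (cases "x = \<zero>")
  case True
  then show ?thesis
    using fin order_gt_0_iff_finite by (simp add: nat_pow_zero)
next
  case False
  then have xm: "x \<in> carrier (mult_of R)"
    using x by simp
  have o: "order R = Suc (order (mult_of R))"
    using fin order_mult_of[OF fin] order_gt_0_iff_finite by simp
  have "x [^] order (mult_of R) = \<one>"
    using group.pow_order_eq_1[OF field_mult_group xm] by (simp add: nat_pow_mult_of)
  then show ?thesis
    using x by (simp add: o)
qed

lemma (in field) subfield_pow_card_eq_self:
  assumes L: "subfield L R" and fin: "finite L" and x: "x \<in> L"
  shows "x [^] card L = x"
proof -
  interpret L: field "R\<lparr>carrier := L\<rparr>"
    using L subfield_iff(2) by blast
  show ?thesis
    using L.pow_order_eq_self fin x
    by (simp add: order_def nat_pow_consistent[symmetric])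
qed

text \<open>A nonzero fixed point is a root of unity of exponent m - 1, of which there are at most m
  - 1; zero accounts for one more.\<close>

lemma (in field) card_pow_fixed_le:
  assumes fin: "finite (carrier R)" and m: "m > 1"
  shows "card {x \<in> carrier R. x [^] (m::nat) = x} \<le> m"
proof -
  have "x [^] (m - 1) = \<one>" if x: "x \<in> carrier R" "x [^] m = x" "x \<noteq> \<zero>" for x
  proof -
    have "x [^] (m - 1) \<otimes> x = \<one> \<otimes> x"
      using m x by (metis nat_pow_Suc Suc_diff_1 l_one less_trans zero_less_one)
    then show ?thesis
      using x by (metis m_rcancel nat_pow_closed one_closed)
  qed
  then have "{x \<in> carrier R. x [^] m = x} \<subseteq> insert \<zero> {x \<in> carrier R. x [^] (m - 1) = \<one>}"
    by auto
  then have "card {x \<in> carrier R. x [^] m = x} \<le> card (insert \<zero> {x \<in> carrier R. x [^] (m - 1) = \<one>})"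
    using fin by (intro card_mono) auto
  also have "\<dots> \<le> Suc (card {x \<in> carrier R. x [^] (m - 1) = \<one>})"
    using fin by (simp add: card_insert_if)
  also have "\<dots> \<le> m"
    using num_roots_le_deg[OF fin, of "m - 1"] m by simp
  finally show ?thesis .
qed

text \<open>Elements of \<open>L\<close> are fixed because its multiplicative group has order
  \<open>card L - 1\<close>, and the set of all fixed points is too small to contain anything
  else.\<close>

lemma (in field) subfield_eq_pow_fixed:
  assumes fin: "finite (carrier R)" and L: "subfield L R"
  shows "L = {x \<in> carrier R. x [^] card L = x}"
proof (rule card_subset_eq)
  have sub: "L \<subseteq> carrier R" and finL: "finite L"
    using subfieldE(3)[OF L] fin by (auto intro: finite_subset)
  have "card {\<zero>, \<one>} \<le> card L"
    using subfieldE[OF L] subringE[of L R] finL by (intro card_mono) (auto intro: subfieldE)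
  then have "card L > 1"
    by simp
  show incl: "L \<subseteq> {x \<in> carrier R. x [^] card L = x}"
    using sub subfield_pow_card_eq_self[OF L finL] by auto
  show "card L = card {x \<in> carrier R. x [^] card L = x}"
    using card_pow_fixed_le[OF fin \<open>card L > 1\<close>] card_mono[OF _ incl] fin by simp
qed (use fin in auto)

lemma (in monoid) pow_pow_fixed:
  assumes x: "x \<in> carrier G" and qd: "x [^] (q ^ d) = x"
  shows "x [^] (q ^ (d * k) :: nat) = x"
  by (induction k) (use x qd in \<open>auto simp: power_add nat_pow_pow[symmetric]\<close>)

text \<open>By Bezout some multiple of \<open>a\<close> exceeds some multiple of \<open>b\<close> by
  the gcd, and both multiples give power maps that fix \<open>x\<close>.\<close>

lemma (in monoid) pow_fixed_gcd:
  assumes x: "x \<in> carrier G" and fa: "x [^] (q ^ a :: nat) = x" and fb: "x [^] (q ^ b) = x"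
    and a: "a > 0"
  shows "x [^] (q ^ gcd a b) = x"
proof -
  obtain u v where uv: "a * u = b * v + gcd a b"
    using bezout_nat[of a b] a by blast
  have "x = x [^] (q ^ (a * u))"
    using pow_pow_fixed[OF x fa] by simp
  also have "\<dots> = (x [^] (q ^ (b * v))) [^] (q ^ gcd a b)"
    using x by (simp add: uv power_add nat_pow_pow)
  also have "\<dots> = x [^] (q ^ gcd a b)"
    using pow_pow_fixed[OF x fb] by simp
  finally show ?thesis
    by simp
qed

section \<open>Counting vectors, and independence of characters modulo a subspace\<close>

text \<open>Coordinates in a basis give a bijection with the lists of length \<open>d\<close> over
  \<open>K\<close>.\<close>

lemma (in ring) card_eq_card_pow_dimension:
  assumes K: "subfield K R" and fin: "finite K" and E: "dimension d K E"
  shows "card E = card K ^ d"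
proof -
  obtain Vs where Vs: "set Vs \<subseteq> carrier R" "independent K Vs" "length Vs = d" "Span K Vs = E"
    using exists_base[OF K E] by auto
  have "bij_betw (\<lambda>Ks. combine Ks Vs) {Ks. set Ks \<subseteq> K \<and> length Ks = d} E"
    unfolding bij_betw_def
  proof
    show "inj_on (\<lambda>Ks. combine Ks Vs) {Ks. set Ks \<subseteq> K \<and> length Ks = d}"
    proof (rule inj_onI)
      fix Ks Ks' assume Ks: "Ks \<in> {Ks. set Ks \<subseteq> K \<and> length Ks = d}"
        and Ks': "Ks' \<in> {Ks. set Ks \<subseteq> K \<and> length Ks = d}"
        and eq: "combine Ks Vs = combine Ks' Vs"
      have "combine Ks Vs \<in> Span K Vs"
        unfolding Span_eq_combine_set_length_version[OF K Vs(1)] Vs(3) using Ks by blast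
      from unique_decomposition[OF K Vs(2) this] obtain Zs where
        Zs: "\<forall>Js. set Js \<subseteq> K \<and> length Js = length Vs \<and> combine Ks Vs = combine Js Vs \<longrightarrow> Js = Zs"
        by (rule ex1E)
      have "Ks = Zs"
        using Ks Vs(3) by (intro Zs[rule_format]) auto
      moreover have "Ks' = Zs"
        using Ks' Vs(3) eq by (intro Zs[rule_format]) auto
      ultimately show "Ks = Ks'"
        by simp
    qed
    show "(\<lambda>Ks. combine Ks Vs) ` {Ks. set Ks \<subseteq> K \<and> length Ks = d} = E"
      unfolding Vs(4)[symmetric] Span_eq_combine_set_length_version[OF K Vs(1)] Vs(3) by blast
  qed
  from bij_betw_same_card[OF this] show ?thesis
    by (simp add: card_lists_length_eq[OF fin])
qed

lemma (in abelian_group) finsum_mem_subgroup: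
  assumes H: "subgroup H (add_monoid G)" and f: "\<And>i. i \<in> A \<Longrightarrow> f i \<in> H"
  shows "finsum G f A \<in> H"
  using f
proof (induction A rule: infinite_finite_induct)
  case (insert i A)
  then have "f i \<in> carrier G" "f \<in> A \<rightarrow> carrier G"
    using subgroup.subset[OF H] by auto
  then show ?case
    using insert subgroup.m_closed[OF H, of "f i" "finsum G f A"] by simp
qed (use subgroup.one_closed[OF H] in auto)

text \<open>Dedekind's argument for distinct characters, with the linear combinations taken modulo an
  \<open>L\<close>-subspace \<open>U\<close>.\<close>

lemma (in field) independence_of_characters_mod:
  assumes L: "subfield L R" and U: "subalgebra L U R"
    and chi: "\<And>i l. l \<in> L \<Longrightarrow> \<chi> i l \<in> L"
    and chi_one: "\<And>i. \<chi> i \<one> = \<one>"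
    and chi_mult: "\<And>i l m. l \<in> L \<Longrightarrow> m \<in> L \<Longrightarrow> \<chi> i (l \<otimes> m) = \<chi> i l \<otimes> \<chi> i m"
    and distinct: "\<And>i j. i < j \<Longrightarrow> j < n \<Longrightarrow> \<exists>l\<in>L. \<chi> i l \<noteq> \<chi> j l"
    and c: "\<And>i. i < n \<Longrightarrow> c i \<in> carrier R"
    and sum: "\<And>l. l \<in> L \<Longrightarrow> (\<Oplus>i\<in>{..<n}. \<chi> i l \<otimes> c i) \<in> U"
    and i: "i < (n::nat)"
  shows "c i \<in> U"
proof -
  interpret U: subalgebra L U R by fact
  have LR: "l \<in> carrier R" if "l \<in> L" for l
    using subfieldE(3)[OF L] that by blast
  have L_one: "\<one> \<in> L" and L_mult: "\<And>l m. l \<in> L \<Longrightarrow> m \<in> L \<Longrightarrow> l \<otimes> m \<in> L"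
    and L_minus: "\<And>l m. l \<in> L \<Longrightarrow> m \<in> L \<Longrightarrow> l \<ominus> m \<in> L"
    using subringE[OF subfieldE(1)[OF L]] by (auto simp: minus_eq)
  have UR: "u \<in> carrier R" if "u \<in> U" for u
    using subalgebra_in_carrier[OF U] that by blast
  have U_add: "u \<oplus> v \<in> U" and U_minus: "u \<ominus> v \<in> U" if "u \<in> U" "v \<in> U" for u v
    using that U.m_closed[of u v] U.m_closed[of u "\<ominus> v"] U.m_inv_closed[of v] UR
    by (auto simp: minus_eq a_inv_def)
  show ?thesis
    using distinct c sum i
  proof (induction n arbitrary: c i)
    case 0
    then show ?case by simp
  next
    case (Suc n)
    have lt: "c j \<in> U" if j: "j < n" for j
    proof -
      obtain m where m: "m \<in> L" "\<chi> j m \<noteq> \<chi> n m"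
        using Suc.prems(1)[of j n] j by auto
      \<comment> \<open>Subtracting \<open>\<chi> n m\<close> times the relation at \<open>l\<close>
        from the relation at \<open>l \<otimes> m\<close> cancels the term of index
        \<open>n\<close>; what remains is a shorter relation with coefficients
        \<open>d i\<close>.\<close>
      define d where "d i = (\<chi> i m \<ominus> \<chi> n m) \<otimes> c i" for i
      have dR: "d i \<in> carrier R" if "i < n" for i
        using that Suc.prems(2) chi[OF m(1)] LR by (auto simp: d_def)
      have "d j \<in> U"
      proof (rule Suc.IH[OF _ _ _ j])
        fix l assume l: "l \<in> L"
        define S where "S = (\<Oplus>i\<in>{..<n}. \<chi> i l \<otimes> c i)"
        define S' where "S' = (\<Oplus>i\<in>{..<n}. \<chi> i (l \<otimes> m) \<otimes> c i)"
        have in_R: "\<chi> i l \<in> carrier R" "\<chi> i m \<in> carrier R" "\<chi> i (l \<otimes> m) \<in> carrier R" for i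
          using l m chi LR L_mult by auto
        have cR: "c i \<in> carrier R" if "i \<le> n" for i
          using Suc.prems(2) that by simp
        have SR: "S \<in> carrier R" "S' \<in> carrier R"
          unfolding S_def S'_def using in_R cR by (auto intro!: finsum_closed)
        have sums: "(\<chi> n l \<otimes> c n) \<oplus> S \<in> U" "(\<chi> n (l \<otimes> m) \<otimes> c n) \<oplus> S' \<in> U"
          using Suc.prems(3)[OF l] Suc.prems(3)[OF L_mult[OF l m(1)]] in_R cR
          unfolding S_def S'_def lessThan_Suc by (subst (asm) (1 2) finsum_insert; auto)+
        have "\<chi> i l \<otimes> d i = \<chi> i (l \<otimes> m) \<otimes> c i \<oplus> (\<ominus> \<chi> n m) \<otimes> (\<chi> i l \<otimes> c i)" if "i < n" for i
          using in_R[of i] in_R[of n] cR[OF less_imp_le[OF that]] unfolding d_def chi_mult[OF l m(1)] by algebra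
        then have "(\<Oplus>i\<in>{..<n}. \<chi> i l \<otimes> d i)
            = (\<Oplus>i\<in>{..<n}. \<chi> i (l \<otimes> m) \<otimes> c i \<oplus> (\<ominus> \<chi> n m) \<otimes> (\<chi> i l \<otimes> c i))"
          using in_R cR by (intro finsum_cong') auto
        also have "\<dots> = S' \<oplus> (\<ominus> \<chi> n m) \<otimes> S"
          unfolding S_def S'_def using in_R cR by (subst finsum_rdistr) (auto intro!: finsum_addf)
        also have "\<dots> = ((\<chi> n (l \<otimes> m) \<otimes> c n) \<oplus> S') \<ominus> \<chi> n m \<otimes> ((\<chi> n l \<otimes> c n) \<oplus> S)"
          using in_R[of n] cR[OF order_refl] SR unfolding chi_mult[OF l m(1)] by algebra
        also have "\<dots> \<in> U"
          using sums U.smult_closed chi m(1) by (intro U_minus) auto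
        finally show "(\<Oplus>i\<in>{..<n}. \<chi> i l \<otimes> d i) \<in> U" .
      qed (use Suc.prems dR in auto)
      \<comment> \<open>\<open>d j\<close> is \<open>k\<close> times \<open>c j\<close>. The inverse
        of \<open>k\<close> lies in \<open>L\<close>, so multiplying by it does not leave
        \<open>U\<close>.\<close>
      define k where "k = \<chi> j m \<ominus> \<chi> n m"
      have k: "k \<in> L" "k \<noteq> \<zero>"
        using chi[OF m(1)] L_minus m(2) LR by (auto simp: k_def)
      then have inv: "inv k \<in> L" "inv k \<otimes> k = \<one>"
        using subfield_m_inv[OF L, of k] by auto
      have "inv k \<otimes> d j = c j"
        using inv k(1) LR Suc.prems(2)[of j] j by (simp add: d_def k_def[symmetric] m_assoc[symmetric])
      then show ?thesis
        using U.smult_closed[OF inv(1) \<open>d j \<in> U\<close>] by simp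
    qed
    \<comment> \<open>At l = 1 the relation is the plain sum of the \<open>c i\<close>, and all its
      terms except \<open>c n\<close> are already in \<open>U\<close>.\<close>
    have "c n \<in> U"
    proof -
      have cR: "c i \<in> carrier R" if "i \<le> n" for i
        using Suc.prems(2) that by simp
      define S where "S = (\<Oplus>i\<in>{..<n}. \<chi> i \<one> \<otimes> c i)"
      have "S \<in> U"
        unfolding S_def
        using lt U.smult_closed chi L_one
        by (intro finsum_mem_subgroup[OF subalgebra.axioms(1)[OF U]]) blast+
      have "c n \<oplus> S \<in> U"
        using Suc.prems(3)[OF L_one] cR LR[OF L_one] chi_one
        unfolding S_def lessThan_Suc by (subst (asm) finsum_insert) auto
      then have "(c n \<oplus> S) \<ominus> S \<in> U"
        using \<open>S \<in> U\<close> U_minus by blast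
      also have "(c n \<oplus> S) \<ominus> S = c n"
        using cR[OF order_refl] UR[OF \<open>S \<in> U\<close>] by algebra
      finally show ?thesis .
    qed
    then show ?case
      using lt Suc.prems(4) less_Suc_eq by blast
  qed
qed


section \<open>Fixed points of additive maps as subspaces\<close>

text \<open>This serves both kernels: \<open>g\<close> is \<open>h\<close> with scalars
  \<open>K\<close>, and the n-th iterate of \<open>h\<close> with scalars \<open>L\<close>.\<close>

lemma (in ring) fixed_points_subalgebra:
  assumes K: "K \<subseteq> carrier R"
    and closed: "\<And>x. x \<in> carrier R \<Longrightarrow> g x \<in> carrier R"
    and add: "\<And>x y. x \<in> carrier R \<Longrightarrow> y \<in> carrier R \<Longrightarrow> g (x \<oplus> y) = g x \<oplus> g y"
    and smult: "\<And>k x. k \<in> K \<Longrightarrow> x \<in> carrier R \<Longrightarrow> g (k \<otimes> x) = k \<otimes> g x"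
  shows "subalgebra K {x \<in> carrier R. g x = x} R"
proof (intro subalgebra.intro subalgebra_axioms.intro)
  have zero: "g \<zero> = \<zero>"
    using add[of \<zero> \<zero>] closed[of \<zero>] by (metis add.l_cancel_one zero_closed l_zero)
  have neg: "g (\<ominus> x) = \<ominus> x" if "x \<in> carrier R" "g x = x" for x
    using add[of "\<ominus> x" x] zero closed[of "\<ominus> x"] that by (metis a_inv_closed l_neg minus_equality)
  show "subgroup {x \<in> carrier R. g x = x} (add_monoid R)"
    using zero neg add by (intro add.subgroupI) auto
qed (use K smult in auto)

lemma (in ring) finite_subalgebra_finite_dimension:
  assumes K: "subfield K R" and V: "subalgebra K V R" and fin: "finite V"
  shows "finite_dimension K V"
proof -
  obtain xs where xs: "set xs = V"
    using finite_list[OF fin] by blast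
  then have "set xs \<subseteq> carrier R"
    using subalgebra_in_carrier[OF V] by simp
  then have "Span K xs = V"
    using subalgebra_Span_incl[OF K V, of xs] Span_base_incl[OF K, of xs] xs by blast
  then show ?thesis
    using Span_finite_dimension[OF K \<open>set xs \<subseteq> carrier R\<close>] by simp
qed

text \<open>Galois descent for the cyclic group generated by \<open>\<sigma>\<close>, with \<open>R\<close> itself as the ambient space.\<close>

locale semilinear_descent = field R for R (structure) +
  fixes K L :: "'a set" and \<sigma> h :: "'a \<Rightarrow> 'a" and n :: nat
  assumes subfield_K: "subfield K R" and subfield_L: "subfield L R"
    and n_pos: "n > 0"
    and sigma_closed: "l \<in> L \<Longrightarrow> \<sigma> l \<in> L"
    and sigma_one: "\<sigma> \<one> = \<one>"
    and sigma_mult: "l \<in> L \<Longrightarrow> m \<in> L \<Longrightarrow> \<sigma> (l \<otimes> m) = \<sigma> l \<otimes> \<sigma> m"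
    and sigma_order: "l \<in> L \<Longrightarrow> (\<sigma> ^^ n) l = l"
    and sigma_pow_nontrivial: "0 < i \<Longrightarrow> i < n \<Longrightarrow> \<exists>l\<in>L. (\<sigma> ^^ i) l \<noteq> l"
    and fixed_field: "K = {l \<in> L. \<sigma> l = l}"
    and h_closed: "x \<in> carrier R \<Longrightarrow> h x \<in> carrier R"
    and h_add: "x \<in> carrier R \<Longrightarrow> y \<in> carrier R \<Longrightarrow> h (x \<oplus> y) = h x \<oplus> h y"
    and h_smult: "l \<in> L \<Longrightarrow> x \<in> carrier R \<Longrightarrow> h (l \<otimes> x) = \<sigma> l \<otimes> h x"
begin

definition "fixed = {x \<in> carrier R. h x = x}"

definition "periodic = {x \<in> carrier R. (h ^^ n) x = x}"

lemma L_carrier: "L \<subseteq> carrier R"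
  by (rule subfieldE(3)[OF subfield_L])

lemma h_zero: "h \<zero> = \<zero>"
  using h_add[of \<zero> \<zero>] h_closed[of \<zero>] by (metis add.l_cancel_one zero_closed l_zero)

lemma h_finsum:
  "finite A \<Longrightarrow> f \<in> A \<rightarrow> carrier R \<Longrightarrow> h (finsum R f A) = (\<Oplus>i\<in>A. h (f i))"
  by (induction A rule: finite_induct) (auto simp: h_zero h_add h_closed Pi_def finsum_closed)

lemma h_pow_closed: "x \<in> carrier R \<Longrightarrow> (h ^^ i) x \<in> carrier R"
  by (induction i) (auto intro: h_closed)

lemma h_pow_add:
  "x \<in> carrier R \<Longrightarrow> y \<in> carrier R \<Longrightarrow> (h ^^ i) (x \<oplus> y) = (h ^^ i) x \<oplus> (h ^^ i) y"
  by (induction i) (auto simp: h_add h_pow_closed)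

lemma sigma_pow_closed: "l \<in> L \<Longrightarrow> (\<sigma> ^^ i) l \<in> L"
  by (induction i) (auto intro: sigma_closed)

lemma sigma_pow_one: "(\<sigma> ^^ i) \<one> = \<one>"
  by (induction i) (auto simp: sigma_one)

lemma sigma_pow_mult:
  "l \<in> L \<Longrightarrow> m \<in> L \<Longrightarrow> (\<sigma> ^^ i) (l \<otimes> m) = (\<sigma> ^^ i) l \<otimes> (\<sigma> ^^ i) m"
  by (induction i) (auto simp: sigma_mult sigma_pow_closed)

lemma h_pow_smult:
  "l \<in> L \<Longrightarrow> x \<in> carrier R \<Longrightarrow> (h ^^ i) (l \<otimes> x) = (\<sigma> ^^ i) l \<otimes> (h ^^ i) x"
  by (induction i) (auto simp: h_smult h_pow_closed sigma_pow_closed)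

text \<open>If two of these powers agreed on \<open>L\<close>, composing with the power n - i of
  \<sigma> and using that the n-th power is trivial would make the power j - i trivial.\<close>

lemma sigma_pow_distinct:
  assumes "i < j" "j < n"
  shows "\<exists>l\<in>L. (\<sigma> ^^ i) l \<noteq> (\<sigma> ^^ j) l"
proof (rule ccontr)
  assume eq: "\<not> ?thesis"
  have "(\<sigma> ^^ (j - i)) l = l" if l: "l \<in> L" for l
  proof -
    have "l = (\<sigma> ^^ (n - i)) ((\<sigma> ^^ i) l)"
      using sigma_order[OF l] assms by (simp flip: funpow_add[unfolded o_def, THEN fun_cong])
    also have "\<dots> = (\<sigma> ^^ (n - i)) ((\<sigma> ^^ j) l)"
      using eq l by simp
    also have "\<dots> = (\<sigma> ^^ (j - i)) ((\<sigma> ^^ n) l)"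
      using assms by (simp add: add.commute flip: funpow_add[unfolded o_def, THEN fun_cong])
    finally show ?thesis
      using sigma_order[OF l] by simp
  qed
  moreover have "0 < j - i" "j - i < n"
    using assms by auto
  ultimately show False
    using sigma_pow_nontrivial by blast
qed

lemma subalgebra_fixed: "subalgebra K fixed R"
  unfolding fixed_def
  by (rule fixed_points_subalgebra) (use fixed_field L_carrier in \<open>auto simp: h_closed h_add h_smult\<close>)

lemma subalgebra_periodic: "subalgebra L periodic R"
  unfolding periodic_def
  by (rule fixed_points_subalgebra)
    (use L_carrier in \<open>auto simp: h_pow_closed h_pow_add h_pow_smult sigma_order\<close>)

lemma fixed_subset_periodic: "fixed \<subseteq> periodic"
proof
  fix x assume x: "x \<in> fixed"
  then have "(h ^^ i) x = x" for i
    by (induction i) (auto simp: fixed_def)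
  then show "x \<in> periodic"
    using x by (simp add: fixed_def periodic_def)
qed

section \<open>Traces, and spanning by fixed vectors\<close>

text \<open>Applying \<open>h\<close> permutes the summands cyclically.\<close>

lemma trace_fixed:
  assumes y: "y \<in> periodic"
  shows "(\<Oplus>i\<in>{..<n}. (h ^^ i) y) \<in> fixed"
proof -
  obtain m where m: "n = Suc m"
    using n_pos gr0_conv_Suc by blast
  have "(h ^^ n) y = y"
    using y by (simp add: periodic_def)
  then have hy: "h ((h ^^ m) y) = y"
    by (simp add: m)
  have yR: "(h ^^ i) y \<in> carrier R" for i
    using y h_pow_closed by (simp add: periodic_def)
  define T where "T = (\<Oplus>i\<in>{..m}. (h ^^ i) y)"
  have TR: "T \<in> carrier R" "h T \<in> carrier R"
    using yR by (auto simp: T_def intro!: finsum_closed h_closed)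
  have "h T = (\<Oplus>i\<in>{..m}. (h ^^ Suc i) y)"
    unfolding T_def using yR by (subst h_finsum) auto
  \<comment> \<open>The sum now runs up to i = n, so \<open>y\<close> occurs at both ends. Splitting
    off the first term leaves \<open>h T\<close>, splitting off the last leaves \<open>T\<close>,
    and \<open>y\<close> cancels.\<close>
  then have "h T \<oplus> y = (\<Oplus>i\<in>{..Suc m}. (h ^^ i) y)"
    using finsum_Suc2[of "\<lambda>i. (h ^^ i) y" m] yR by (simp add: Pi_def)
  also have "\<dots> = y \<oplus> T"
    using finsum_Suc[of "\<lambda>i. (h ^^ i) y" m] yR hy by (simp add: T_def Pi_def)
  finally have "h T = T"
    using TR yR[of 0] by (simp add: a_comm[of y])
  then show ?thesis
    using TR by (simp add: fixed_def T_def m lessThan_Suc_atMost)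
qed

lemma periodic_subset_subalgebra:
  assumes U: "subalgebra L U R" and sub: "fixed \<subseteq> U"
  shows "periodic \<subseteq> U"
proof
  fix x assume x: "x \<in> periodic"
  then have xR: "x \<in> carrier R"
    by (simp add: periodic_def)
  \<comment> \<open>\<open>x\<close> is the coefficient of index 0 in the trace of
    \<open>l \<otimes> x\<close>; index 0 is admissible because \<open>n\<close> is
    positive.\<close>
  have "(h ^^ 0) x \<in> U"
  proof (rule independence_of_characters_mod[OF subfield_L U, where \<chi> = "\<lambda>i. \<sigma> ^^ i" and n = n])
    fix l assume l: "l \<in> L"
    have "(\<Oplus>i\<in>{..<n}. (h ^^ i) (l \<otimes> x)) \<in> fixed"
      using subalgebra.smult_closed[OF subalgebra_periodic l x] by (rule trace_fixed)
    then show "(\<Oplus>i\<in>{..<n}. (\<sigma> ^^ i) l \<otimes> (h ^^ i) x) \<in> U"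
      using sub l xR by (auto simp: h_pow_smult)
  qed (use xR n_pos in \<open>simp_all add: sigma_pow_closed sigma_pow_one sigma_pow_mult sigma_pow_distinct h_pow_closed\<close>)
  then show "x \<in> U"
    by simp
qed

section \<open>Independence over the larger field, and equality of dimensions\<close>

lemma h_combine:
  assumes "set ls \<subseteq> L" "set us \<subseteq> fixed"
  shows "h (combine ls us) = combine (map \<sigma> ls) us"
  using assms
proof (induction ls us rule: combine.induct)
  case (1 l ls u us)
  then have "l \<in> L" "l \<in> carrier R" "u \<in> carrier R" "h u = u" "combine ls us \<in> carrier R"
    using L_carrier by (auto simp: fixed_def)
  then show ?case
    using 1 by (simp add: h_add h_smult)
qed (auto simp: h_zero)

lemma independent_fixed:
  assumes "independent K us" "set us \<subseteq> fixed"
  shows "independent L us"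
  using assms
proof (induction us rule: list.induct)
  case (Cons u us)
  have uR: "u \<in> carrier R" "set us \<subseteq> carrier R" and hu: "h u = u"
    using Cons.prems by (auto simp: fixed_def)
  have uK: "u \<notin> Span K us" and iK: "independent K us"
    using Cons.prems(1) by (auto elim: independent.cases)
  have iL: "independent L us"
    using Cons iK by simp
  have "u \<notin> Span L us"
  proof
    assume u: "u \<in> Span L us"
    then obtain ls where ls: "set ls \<subseteq> L" "length ls = length us" "u = combine ls us"
      using Span_mem_iff_length_version[OF subfield_L uR(2)] by blast
    from unique_decomposition[OF subfield_L iL u] obtain ms where
      ms: "\<forall>js. set js \<subseteq> L \<and> length js = length us \<and> u = combine js us \<longrightarrow> js = ms"
      by (rule ex1E)
    \<comment> \<open>Both \<open>u\<close> and the vectors in \<open>us\<close> are fixed by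
      \<open>h\<close>, so \<open>h\<close> produces a second decomposition of \<open>u\<close>.
      Uniqueness makes each coefficient fixed by \<sigma>, hence an element of \<open>K\<close>,
      against independence over \<open>K\<close>.\<close>
    have "u = combine (map \<sigma> ls) us"
      using h_combine[of ls us] hu ls Cons.prems(2) by simp
    then have "map \<sigma> ls = ms"
      using ls sigma_closed by (intro ms[rule_format]) auto
    moreover have "ls = ms"
      using ls by (intro ms[rule_format]) auto
    ultimately have "map \<sigma> ls = map id ls"
      by simp
    then have "set ls \<subseteq> K"
      using ls(1) unfolding map_eq_conv fixed_field by auto
    then show False
      using uK ls Span_mem_iff_length_version[OF subfield_K uR(2)] by blast
  qed
  then show ?case
    using uR(1) iL by (intro li_Cons)
qed simp

text \<open>The same list of vectors is a basis of \<open>fixed\<close> over \<open>K\<close> and of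
  \<open>periodic\<close> over \<open>L\<close>. Its \<open>L\<close>-span contains
  \<open>fixed\<close> since \<open>K\<close> is part of \<open>L\<close>, so the spanning result
  applies with this span as \<open>U\<close>.\<close>

lemma dimension_fixed_imp_periodic:
  assumes "dimension d K fixed"
  shows "dimension d L periodic"
proof -
  obtain us where us: "set us \<subseteq> carrier R" "independent K us" "length us = d" "Span K us = fixed"
    using exists_base[OF subfield_K assms] by blast
  have us_fixed: "set us \<subseteq> fixed"
    using Span_base_incl[OF subfield_K us(1)] us(4) by simp
  have "Span L us \<subseteq> periodic"
    using us_fixed fixed_subset_periodic by (intro subalgebra_Span_incl[OF subfield_L subalgebra_periodic]) auto
  moreover have "Span K us \<subseteq> Span L us"
    unfolding Span_eq_combine_set[OF subfield_K us(1)] Span_eq_combine_set[OF subfield_L us(1)]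
    using fixed_field by blast
  then have "periodic \<subseteq> Span L us"
    using us(4) Span_is_subalgebra[OF subfield_L us(1)] by (intro periodic_subset_subalgebra) auto
  ultimately have "Span L us = periodic"
    by simp
  then show ?thesis
    using dimensionI[OF subfield_L independent_fixed[OF us(2) us_fixed]] us(3) by simp
qed

end


section \<open>The descent applied to G composed with \<sigma>\<close>

text \<open>The order of the additive group annihilates 1, and in a domain a product of copies of
  \<open>p\<close> times 1 vanishes only if one factor does.\<close>

lemma (in domain) add_pow_one_eq_zero_of_order:
  assumes "order R = p ^ m"
  shows "[(p::nat)] \<cdot> \<one> = \<zero>"
proof (rule ccontr)
  assume p: "[p] \<cdot> \<one> \<noteq> \<zero>"
  have "[(p ^ k)] \<cdot> \<one> \<noteq> \<zero>" for k
  proof (induction k)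
    case (Suc k)
    have "[(p ^ Suc k)] \<cdot> \<one> = ([p] \<cdot> \<one>) \<otimes> ([(p ^ k)] \<cdot> \<one>)"
      by (simp add: add_pow_ldistr add.nat_pow_pow mult.commute)
    then show ?case
      using p Suc by (simp add: integral_iff)
  qed simp
  moreover have "[(order R)] \<cdot> \<one> = \<zero>"
    using add.pow_order_eq_1[of \<one>] by (simp add: order_def)
  ultimately show False
    by (simp add: assms)
qed

theorem theorem1p5:
  fixes F :: "('a, 'm) ring_scheme"
    and K L :: "'a set"
    and q n t s :: nat
    and b :: "nat \<Rightarrow> 'a"
  assumes q: "primepow q"
    and n: "n > 0" and t: "t > 0"
    and s: "s > 0" "gcd s n = 1"
    and F: "field F" "finite (carrier F)" "order F = q ^ (n * t)"
    and K: "subfield K F" "card K = q"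
    and L: "subfield L F" "card L = q ^ n"
    and b: "b \<in> {..<t} \<rightarrow> carrier F"
  defines "H \<equiv> G_map F q n t b \<circ> frob F q s"
  defines "ker_f \<equiv> a_kernel F F (f_map F q n t s b)"
    and "ker_Hn \<equiv> a_kernel F F (\<lambda>x. (H ^^ n) x \<ominus>\<^bsub>F\<^esub> x)"
  shows "ring.finite_dimension F K ker_f \<and> ring.finite_dimension F L ker_Hn
    \<and> ring.dim F K ker_f \<le> t
    \<and> (ker_f = {\<zero>\<^bsub>F\<^esub>} \<longleftrightarrow> ker_Hn = {\<zero>\<^bsub>F\<^esub>})
    \<and> ring.dim F K ker_f = ring.dim F L ker_Hn
    \<and> (ring.dim F K ker_f = t \<longleftrightarrow> (\<forall>x\<in>carrier F. (H ^^ n) x = x))"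
proof -
  interpret field F by fact
  have q1: "q > 1"
    using q primepow_gt_Suc_0 by simp
  have bR: "b i \<in> carrier F" if "i < t" for i
    using b that by auto
  have L_iff: "x \<in> L \<longleftrightarrow> x \<in> carrier F \<and> x [^]\<^bsub>F\<^esub> (q ^ n) = x" for x
    using subfield_eq_pow_fixed[OF F(2) L(1)] unfolding L(2) by blast
  \<comment> \<open>The exponent is kept as \<open>q ^ 1\<close> so that the lemmas on powers of
    \<open>q\<close> apply to \<open>K\<close> as they do to \<open>L\<close>.\<close>
  have K_iff: "x \<in> K \<longleftrightarrow> x \<in> carrier F \<and> x [^]\<^bsub>F\<^esub> (q ^ 1) = x" for x
    using subfield_eq_pow_fixed[OF F(2) K(1)] unfolding K(2) power_one_right by blast
  have pow_add: "(x \<oplus>\<^bsub>F\<^esub> y) [^]\<^bsub>F\<^esub> (q ^ k) = x [^]\<^bsub>F\<^esub> (q ^ k) \<oplus>\<^bsub>F\<^esub> y [^]\<^bsub>F\<^esub> (q ^ k)"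
    if "x \<in> carrier F" "y \<in> carrier F" for x y k
  proof -
    obtain p e where p: "prime p" "q = p ^ e"
      using q by (auto simp: primepow_def)
    have "order F = p ^ (e * (n * t))"
      by (simp add: F(3) p(2) power_mult)
    from pow_prime_power_add[OF that p(1) add_pow_one_eq_zero_of_order[OF this], of "e * k"]
    show ?thesis
      by (simp add: p(2) power_mult)
  qed
  have frob_pow: "(frob F q s ^^ i) x = x [^]\<^bsub>F\<^esub> (q ^ (s * i))" if "x \<in> carrier F" for x i
    using that by (induction i) (auto simp: frob_def nat_pow_pow power_add mult.commute)
  have G_closed: "G_map F q n t b x \<in> carrier F" if "x \<in> carrier F" for x
    unfolding G_map_def using that bR by (auto intro!: finsum_closed)
  have G_add: "G_map F q n t b (x \<oplus>\<^bsub>F\<^esub> y) = G_map F q n t b x \<oplus>\<^bsub>F\<^esub> G_map F q n t b y"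
    if "x \<in> carrier F" "y \<in> carrier F" for x y
  proof -
    have "G_map F q n t b (x \<oplus>\<^bsub>F\<^esub> y) =
        (\<Oplus>\<^bsub>F\<^esub>i\<in>{..<t}. b i \<otimes>\<^bsub>F\<^esub> x [^]\<^bsub>F\<^esub> (q ^ (n * i)) \<oplus>\<^bsub>F\<^esub> b i \<otimes>\<^bsub>F\<^esub> y [^]\<^bsub>F\<^esub> (q ^ (n * i)))"
      unfolding G_map_def using that bR by (intro finsum_cong') (auto simp: pow_add r_distr)
    also have "\<dots> = G_map F q n t b x \<oplus>\<^bsub>F\<^esub> G_map F q n t b y"
      unfolding G_map_def using that bR by (intro finsum_addf) auto
    finally show ?thesis .
  qed
  \<comment> \<open>The exponents in \<open>G\<close> are powers of \<open>q ^ n\<close>, which fix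
    \<open>L\<close> pointwise; thus the twist in the semilinearity of \<open>H\<close> comes from
    \<sigma> alone.\<close>
  have G_smult: "G_map F q n t b (l \<otimes>\<^bsub>F\<^esub> x) = l \<otimes>\<^bsub>F\<^esub> G_map F q n t b x"
    if l: "l \<in> L" and x: "x \<in> carrier F" for l x
  proof -
    have lR: "l \<in> carrier F" and l_pow: "l [^]\<^bsub>F\<^esub> (q ^ (n * i)) = l" for i
      using l pow_pow_fixed[of l q n i] by (auto simp: L_iff)
    have "G_map F q n t b (l \<otimes>\<^bsub>F\<^esub> x) = (\<Oplus>\<^bsub>F\<^esub>i\<in>{..<t}. l \<otimes>\<^bsub>F\<^esub> (b i \<otimes>\<^bsub>F\<^esub> x [^]\<^bsub>F\<^esub> (q ^ (n * i))))"
      unfolding G_map_def using lR x bR by (intro finsum_cong') (auto simp: nat_pow_distrib l_pow m_lcomm)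
    also have "\<dots> = l \<otimes>\<^bsub>F\<^esub> G_map F q n t b x"
      unfolding G_map_def using lR x bR by (intro finsum_rdistr[symmetric]) auto
    finally show ?thesis .
  qed
  have pow_L: "l [^]\<^bsub>F\<^esub> (k::nat) \<in> L" if "l \<in> L" for l k
    using that by (auto simp: L_iff) (metis nat_pow_pow mult.commute)
  interpret D: semilinear_descent F K L "frob F q s" H n
  proof (intro semilinear_descent.intro semilinear_descent_axioms.intro)
    show "(frob F q s ^^ n) l = l" if "l \<in> L" for l
      using that pow_pow_fixed[of l q n s] by (simp add: frob_pow L_iff mult.commute)
    \<comment> \<open>Otherwise all of \<open>L\<close> is fixed by the power map with exponent
      \<open>q ^ gcd n (s * i)\<close>. As \<open>s\<close> is prime to \<open>n\<close>, this gcd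
      divides \<open>i\<close> and is less than \<open>n\<close>, so there are too few fixed points
      for the \<open>q ^ n\<close> elements of \<open>L\<close>.\<close>
    show "\<exists>l\<in>L. (frob F q s ^^ i) l \<noteq> l" if i: "0 < i" "i < n" for i
    proof (rule ccontr)
      assume fixed: "\<not> ?thesis"
      have "coprime s n"
        using s(2) by (simp only: coprime_iff_gcd_eq_1)
      then have "coprime (gcd n (s * i)) s"
        using coprime_divisors[of "gcd n (s * i)" n s s] by (simp add: coprime_commute)
      then have "gcd n (s * i) dvd i"
        using coprime_dvd_mult_right_iff[of "gcd n (s * i)" s i] by blast
      then have g: "gcd n (s * i) \<le> i" "gcd n (s * i) > 0"
        using i n by (auto intro: dvd_imp_le)
      have "l [^]\<^bsub>F\<^esub> (q ^ gcd n (s * i)) = l" if "l \<in> L" for l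
        using fixed that n by (intro pow_fixed_gcd) (auto simp: L_iff frob_pow)
      then have "L \<subseteq> {x \<in> carrier F. x [^]\<^bsub>F\<^esub> (q ^ gcd n (s * i)) = x}"
        by (auto simp: L_iff)
      then have "card L \<le> card {x \<in> carrier F. x [^]\<^bsub>F\<^esub> (q ^ gcd n (s * i)) = x}"
        using F(2) by (intro card_mono) auto
      also have "\<dots> \<le> q ^ gcd n (s * i)"
        using q1 g(2) by (intro card_pow_fixed_le[OF F(2)] one_less_power)
      also have "\<dots> < q ^ n"
        using q1 g(1) i by (intro power_strict_increasing) auto
      finally show False
        by (simp add: L(2))
    qed
    show "K = {l \<in> L. frob F q s l = l}"
    proof (intro equalityI subsetI)
      fix x assume "x \<in> K"
      then show "x \<in> {l \<in> L. frob F q s l = l}"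
        using pow_pow_fixed[of x q 1 s] pow_pow_fixed[of x q 1 n] by (auto simp: K_iff L_iff frob_def)
    next
      \<comment> \<open>Being fixed by the exponents \<open>q ^ s\<close> and \<open>q ^ n\<close>
        implies being fixed by \<open>q\<close> itself, since the gcd of \<open>s\<close> and
        \<open>n\<close> is 1.\<close>
      fix x assume "x \<in> {l \<in> L. frob F q s l = l}"
      then show "x \<in> K"
        using pow_fixed_gcd[of x q s n] s by (auto simp: K_iff L_iff frob_def)
    qed
  qed (use F(1) K(1) L(1) n in \<open>auto simp: H_def frob_def L_iff[THEN iffD1] pow_L G_closed G_add G_smult pow_add nat_pow_distrib\<close>)
  have HR: "(H ^^ i) x \<in> carrier F" if "x \<in> carrier F" for x i
    using that by (rule D.h_pow_closed)
  have kers: "ker_f = D.fixed" "ker_Hn = D.periodic"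
    using f_map_eq_G_map_frob[OF F(1) b, of _ q n s] HR D.h_closed
    by (auto simp: ker_f_def ker_Hn_def D.fixed_def D.periodic_def a_kernel_def' H_def[symmetric])
  have finK: "finite_dimension K D.fixed"
    using F(2) by (intro finite_subalgebra_finite_dimension[OF K(1) D.subalgebra_fixed]) (simp add: D.fixed_def)
  then obtain d where dK: "dimension d K D.fixed"
    by (rule finite_dimensionE')
  note dL = D.dimension_fixed_imp_periodic[OF dK]
  have dims: "dim K D.fixed = d" "dim L D.periodic = d"
    using dimI[OF K(1) dK] dimI[OF L(1) dL] by (simp_all add: over_def)
  have finL: "finite L"
    using L(2) q1 by (intro card_ge_0_finite) simp
  have card: "card D.periodic = (q ^ n) ^ d"
    using card_eq_card_pow_dimension[OF L(1) finL dL] L(2) by simp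
  have carrier: "card (carrier F) = (q ^ n) ^ t"
    using F(3) by (simp add: order_def power_mult)
  have qn: "q ^ n > 1"
    using q1 n by (intro one_less_power)
  have sub: "D.periodic \<subseteq> carrier F"
    by (auto simp: D.periodic_def)
  \<comment> \<open>\<open>periodic\<close> has (q^n)^d elements inside a field of (q^n)^t elements,
    and q^n > 1 allows the exponents to be compared. Equality of the exponents means that
    \<open>periodic\<close> is the whole field.\<close>
  have "d \<le> t"
    using card_mono[OF F(2) sub] qn unfolding card carrier by (simp add: power_increasing_iff)
  moreover have "d = t \<longleftrightarrow> D.periodic = carrier F"
    using card_subset_eq[OF F(2) sub] qn unfolding card carrier
    by (metis card carrier power_inject_exp)
  then have "d = t \<longleftrightarrow> (\<forall>x\<in>carrier F. (H ^^ n) x = x)"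
    by (auto simp: D.periodic_def)
  \<comment> \<open>Each kernel is trivial exactly when the common dimension \<open>d\<close> is 0,
    which links the two conditions.\<close>
  moreover have "D.fixed = {\<zero>\<^bsub>F\<^esub>} \<longleftrightarrow> d = 0" "D.periodic = {\<zero>\<^bsub>F\<^esub>} \<longleftrightarrow> d = 0"
    using dK dL dimension_zero[OF K(1)] dimension_zero[OF L(1)] zero_dim
      dimension_is_inj[OF K(1)] dimension_is_inj[OF L(1)] by metis+
  ultimately show ?thesis
    using finK finite_dimensionI[OF dL] by (simp add: kers dims)
qed

end
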